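(* Let $\alpha>\frac12$ and let $0<c_1\le c_2$. For all $R\ge0$ and every reconstructing rank-1 lattice $\Lambda(\boldsymbol z,M)$ for $G_R^2$ with $c_1 2^{2R}\le M\le c_2 2^{2R}$, $$\big\|\mathrm{Id}-S^{\Lambda(\boldsymbol z,M)}_{G_R^2}\big|\mathcal{H}^{\alpha}_{\mathrm{mix}}(\mathbb{T}^2)\to L_\infty(\mathbb{T}^2)\big\|\lesssim M^{-(\alpha-\frac12)/2},$$ with a constant depending only on $\alpha,c_1,c_2$.
   Context: $\mathbb{T}=[0,1)$ is the torus, $\hat f_{\boldsymbol k}=\int_{\mathbb{T}^2}f(\boldsymbol x)e^{-2\pi i\boldsymbol k\cdot\boldsymbol x}\,d\boldsymbol x$. $\mathcal{H}^{\alpha}_{\mathrm{mix}}(\mathbb{T}^2)$ is the space of $f\in L_2(\mathbb{T}^2)$ with finite norm $$\|f|\mathcal{H}^{\alpha}_{\mathrm{mix}}(\mathbb{T}^2)\|^2=\sum_{\boldsymbol k\in\mathbb{Z}^2}|\hat f_{\boldsymbol k}|^2\prod_{s=1}^2(1+|k_s|^2)^{\alpha}.$$ For $\alpha>\frac12$ its elements are continuous (after choosing the continuous representative). $G_R^2:=(-2^{\lfloor R\rfloor-1},2^{\lfloor R\rfloor-1}]^2\cap\mathbb{Z}^2$. For $\boldsymbol z\in\mathbb{Z}^2$, $M\in\mathbb{N}$, the rank-1 lattice is $\Lambda(\boldsymbol z,M)=\{\frac jM\boldsymbol z\bmod\boldsymbol 1:j=0,\dots,M-1\}$. For finite $I\subset\mathbb{Z}^2$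 the sampling operator is $$S_I^{\Lambda(\boldsymbol z,M)}f=\sum_{\boldsymbol k\in I}\hat f_{\boldsymbol k}^{\Lambda(\boldsymbol z,M)}e^{2\pi i\boldsymbol k\cdot\circ},\qquad \hat f_{\boldsymbol k}^{\Lambda(\boldsymbol z,M)}=\frac1M\sum_{j=0}^{M-1}f\big(\tfrac jM\boldsymbol z\big)e^{-2\pi i\frac jM\boldsymbol k\cdot\boldsymbol z}.$$ $\Lambda(\boldsymbol z,M)$ is a reconstructing rank-1 lattice for $I$ if $S_I^{\Lambda(\boldsymbol z,M)}p=p$ for all trigonometric polynomials $p$ with frequencies in $I$; equivalently $\boldsymbol k^1\cdot\boldsymbol z\not\equiv\boldsymbol k^2\cdot\boldsymbol z\pmod M$ for all distinct $\boldsymbol k^1,\boldsymbol k^2\in I$. $\|A|X\to Y\|$ is the operator norm; $a\lesssim b$ means $a\le c\,b$ with a constant $c>0$ depending only on the indicated parameters (not on $R,\boldsymbol z,M$). *)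

theory Defs
  imports "HOL-Probability.Probability"
begin

text \<open>
  Functions on the two-dimensional torus are represented by functions on the plane that are
  1-periodic in each coordinate; integrals and almost-everywhere statements refer to Lebesgue
  measure on the fundamental domain.  With periodicity, the reduction modulo 1 of the nodes of a
  rank-1 lattice is not needed.
\<close>

definition torus_measure :: "(real \<times> real) measure" where
  "torus_measure = lebesgue_on ({0..<1} \<times> {0..<1})"

definition periodic_fun2 :: "(real \<times> real \<Rightarrow> complex) \<Rightarrow> bool" where
  "periodic_fun2 f \<longleftrightarrow> (\<forall>x y. f (x + 1, y) = f (x, y) \<and> f (x, y + 1) = f (x, y))"

definition torus_char :: "int \<times> int \<Rightarrow> real \<times> real \<Rightarrow> complex" where
  "torus_char k x =
     exp (2 * of_real pi * \<i> * of_real (of_int (fst k) * fst x + of_int (snd k) * snd x))"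

definition fourier_coeff :: "(real \<times> real \<Rightarrow> complex) \<Rightarrow> int \<times> int \<Rightarrow> complex" where
  "fourier_coeff f k = (\<integral>x. f x * torus_char (- k) x \<partial>torus_measure)"

definition L2_torus :: "(real \<times> real \<Rightarrow> complex) set" where
  "L2_torus = {f. periodic_fun2 f \<and> f \<in> borel_measurable torus_measure \<and>
                  integrable torus_measure (\<lambda>x. (cmod (f x))\<^sup>2)}"

definition mix_weight :: "real \<Rightarrow> int \<times> int \<Rightarrow> real" where
  "mix_weight \<alpha> k = (1 + \<bar>real_of_int (fst k)\<bar>\<^sup>2) powr \<alpha> * (1 + \<bar>real_of_int (snd k)\<bar>\<^sup>2) powr \<alpha>"

definition Hmix :: "real \<Rightarrow> (real \<times> real \<Rightarrow> complex) set" where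
  "Hmix \<alpha> = {f \<in> L2_torus. (\<lambda>k. (cmod (fourier_coeff f k))\<^sup>2 * mix_weight \<alpha> k) summable_on UNIV}"

definition Hmix_norm :: "real \<Rightarrow> (real \<times> real \<Rightarrow> complex) \<Rightarrow> real" where
  "Hmix_norm \<alpha> f = sqrt (\<Sum>\<^sub>\<infinity>k. (cmod (fourier_coeff f k))\<^sup>2 * mix_weight \<alpha> k)"

definition Linf_norm :: "(real \<times> real \<Rightarrow> complex) \<Rightarrow> ereal" where
  "Linf_norm f = esssup torus_measure (\<lambda>x. ereal (cmod (f x)))"

text \<open>
  Elements of \<^const>\<open>Hmix\<close> are only determined almost everywhere.  Point evaluation
  refers to the continuous representative, which for \<open>\<alpha> > 1/2\<close> exists and is unique.
\<close>

definition continuous_rep :: "(real \<times> real \<Rightarrow> complex) \<Rightarrow> (real \<times> real \<Rightarrow> complex)" where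
  "continuous_rep f = (SOME g. continuous_on UNIV g \<and> periodic_fun2 g \<and>
                               (AE x in torus_measure. g x = f x))"

definition freq_grid :: "real \<Rightarrow> (int \<times> int) set" where
  "freq_grid R = {k. \<forall>l \<in> {fst k, snd k}.
     - (2 powr (of_int \<lfloor>R\<rfloor> - 1)) < real_of_int l \<and> real_of_int l \<le> 2 powr (of_int \<lfloor>R\<rfloor> - 1)}"

definition lattice_node :: "int \<times> int \<Rightarrow> nat \<Rightarrow> nat \<Rightarrow> real \<times> real" where
  "lattice_node z M j = (real j / real M * of_int (fst z), real j / real M * of_int (snd z))"

definition lattice_coeff ::
    "int \<times> int \<Rightarrow> nat \<Rightarrow> (real \<times> real \<Rightarrow> complex) \<Rightarrow> int \<times> int \<Rightarrow> complex" where
  "lattice_coeff z M f k =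
     1 / of_nat M * (\<Sum>j<M. f (lattice_node z M j) * torus_char (- k) (lattice_node z M j))"

definition sampling_op ::
    "(int \<times> int) set \<Rightarrow> int \<times> int \<Rightarrow> nat \<Rightarrow> (real \<times> real \<Rightarrow> complex) \<Rightarrow> (real \<times> real \<Rightarrow> complex)" where
  "sampling_op I z M f = (\<lambda>x. \<Sum>k\<in>I. lattice_coeff z M f k * torus_char k x)"

definition trig_polys :: "(int \<times> int) set \<Rightarrow> (real \<times> real \<Rightarrow> complex) set" where
  "trig_polys I = {p. \<exists>a. p = (\<lambda>x. \<Sum>k\<in>I. a k * torus_char k x)}"

definition reconstructing_lattice :: "int \<times> int \<Rightarrow> nat \<Rightarrow> (int \<times> int) set \<Rightarrow> bool" where
  "reconstructing_lattice z M I \<longleftrightarrow> (\<forall>p \<in> trig_polys I. sampling_op I z M p = p)"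

definition operator_norm ::
    "'a set \<Rightarrow> ('a \<Rightarrow> real) \<Rightarrow> ('b \<Rightarrow> ereal) \<Rightarrow> ('a \<Rightarrow> 'b) \<Rightarrow> ereal" where
  "operator_norm X normX normY T = (SUP f\<in>{f \<in> X. normX f \<le> 1}. normY (T f))"

end

theory Submission imports Defs begin

text \<open>
  For \<open>\<alpha> > 1/2\<close> the Fourier coefficients \<open>a\<close> of \<open>f\<close> are absolutely summable, so by completeness of
  the characters (Stone--Weierstrass) the continuous representative of \<open>f\<close> is its Fourier series.
  On a reconstructing lattice the sampling operator fixes every character with frequency in the
  grid and maps any other character to at most one character of the grid.  Hence the error is
  pointwise at most \<open>2 * (\<Sum>k\<notin>G. cmod (a k))\<close>, which Cauchy--Schwarz bounds by
  the norm of \<open>f\<close> times the square root of \<open>\<Sum>k\<notin>G. 1 / mix_weight \<alpha> k\<close>.  Outside the grid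
  one of the two frequencies is at least \<open>2 powr (R - 2)\<close>, so that tail is of order
  \<open>2 powr (- R * (2 * \<alpha> - 1))\<close>, that is, \<open>M powr (- (\<alpha> - 1/2))\<close>.
\<close>

section \<open>Characters of the torus\<close>

lemma torus_char_0 [simp]: "torus_char 0 x = 1"
  by (simp add: torus_char_def)

lemma torus_char_at_0 [simp]: "torus_char k 0 = 1"
  by (simp add: torus_char_def)

lemma torus_char_add: "torus_char (k + l) x = torus_char k x * torus_char l x"
  by (simp add: torus_char_def exp_add [symmetric] algebra_simps)

lemma norm_torus_char [simp]: "cmod (torus_char k x) = 1"
proof -
  have "torus_char k x = exp (\<i> * of_real (2 * pi * (of_int (fst k) * fst x + of_int (snd k) * snd x)))"
    by (simp add: torus_char_def mult_ac)
  then show ?thesis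
    by (simp only: norm_exp_i_times)
qed

lemma torus_char_1_2: "torus_char k (x, y) = torus_char (fst k, 0) (x, 0) * torus_char (0, snd k) (0, y)"
  by (simp add: torus_char_def exp_add [symmetric] algebra_simps)

lemma torus_char_int: "torus_char k (of_int m, of_int n) = 1"
proof -
  have "torus_char k (of_int m, of_int n) =
      exp (2 * of_real pi * \<i> * of_int (fst k * m + snd k * n))"
    by (simp add: torus_char_def)
  then show ?thesis
    using exp_integer_2pi [of "of_int (fst k * m + snd k * n)"] by (simp add: mult_ac)
qed

lemma torus_char_add_arg: "torus_char k (x + y) = torus_char k x * torus_char k y"
  by (simp add: torus_char_def exp_add [symmetric] algebra_simps)

lemma periodic_torus_char: "periodic_fun2 (torus_char k)"
  unfolding periodic_fun2_def
proof (intro allI conjI)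
  fix x y :: real
  show "torus_char k (x + 1, y) = torus_char k (x, y)"
    using torus_char_add_arg [of k "(x, y)" "(of_int 1, of_int 0)"] torus_char_int [of k 1 0] by simp
  show "torus_char k (x, y + 1) = torus_char k (x, y)"
    using torus_char_add_arg [of k "(x, y)" "(of_int 0, of_int 1)"] torus_char_int [of k 0 1] by simp
qed

lemma continuous_on_torus_char [continuous_intros]: "continuous_on A (torus_char k)"
  unfolding torus_char_def by (intro continuous_intros)

lemma integral_exp_period:
  fixes m :: int
  shows "integral {0..1} (\<lambda>x::real. exp (2 * of_real pi * \<i> * of_real (of_int m * x))) = of_bool (m = 0)"
proof (cases "m = 0")
  case True
  then show ?thesis by simp
next
  case False
  define c where "c = 2 * of_real pi * \<i> * complex_of_int m"
  have c: "c \<noteq> 0"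
    using False by (simp add: c_def)
  have "((\<lambda>x. exp (c * of_real x)) has_integral
      (exp (c * of_real 1) / c - exp (c * of_real 0) / c)) {0..1}"
  proof (rule fundamental_theorem_of_calculus)
    fix x :: real
    have "((\<lambda>z. exp (c * z) / c) has_field_derivative exp (c * of_real x)) (at (of_real x))"
      using c by (auto intro!: derivative_eq_intros)
    from has_vector_derivative_real_field [OF this]
    show "((\<lambda>x. exp (c * of_real x) / c) has_vector_derivative exp (c * of_real x)) (at x within {0..1})" .
  qed simp
  moreover have "exp c = 1"
    using exp_integer_2pi [of "of_int m"] by (simp add: c_def mult_ac)
  ultimately have "((\<lambda>x. exp (c * of_real x)) has_integral 0) {0..1::real}"
    by simp
  then show ?thesis
    using False by (simp add: c_def integral_unique mult.assoc)
qed

section \<open>Integration over the torus\<close>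

lemma sets_torus [simp]: "{0..<1::real} \<times> {0..<1::real} \<in> sets lebesgue"
  by (intro sets_completionI_sets) (simp add: borel_Times)

lemma emeasure_torus [simp]: "emeasure torus_measure (space torus_measure) = 1"
proof -
  have "emeasure lborel ({0..<1::real} \<times> {0..<1::real}) = 1"
    by (simp add: lborel_prod [symmetric] lborel.emeasure_pair_measure_Times)
  then show ?thesis
    by (simp add: torus_measure_def emeasure_restrict_space space_restrict_space emeasure_completion borel_Times)
qed

lemma space_torus [simp]: "space torus_measure = {0..<1} \<times> {0..<1}"
  by (simp add: torus_measure_def)

interpretation torus: prob_space torus_measure
  by (rule prob_spaceI) (rule emeasure_torus)

lemma continuous_measurable_torus:
  fixes f :: "real \<times> real \<Rightarrow> 'a::euclidean_space"
  shows "continuous_on UNIV f \<Longrightarrow> f \<in> borel_measurable torus_measure"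
  unfolding torus_measure_def
  by (rule continuous_imp_measurable_on_sets_lebesgue) (auto intro: continuous_on_subset)

lemma integrable_torus_bounded_mult:
  fixes F u :: "real \<times> real \<Rightarrow> complex"
  assumes "integrable torus_measure F" "u \<in> borel_measurable torus_measure" "\<And>x. cmod (u x) \<le> B"
  shows "integrable torus_measure (\<lambda>x. F x * u x)"
proof (rule Bochner_Integration.integrable_bound)
  show "integrable torus_measure (\<lambda>x. B * cmod (F x))"
    using assms(1) by simp
  show "AE x in torus_measure. cmod (F x * u x) \<le> norm (B * cmod (F x))"
  proof (rule AE_I2)
    fix x
    have "0 \<le> B"
      using assms(3) [of x] norm_ge_zero order_trans by blast
    then show "cmod (F x * u x) \<le> norm (B * cmod (F x))"
      using mult_right_mono [OF assms(3) [of x], of "cmod (F x)"]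
      by (simp add: norm_mult abs_mult mult.commute)
  qed
qed (use assms in measurable)

lemma integrable_torus_bounded:
  fixes u :: "real \<times> real \<Rightarrow> complex"
  assumes "u \<in> borel_measurable torus_measure" "\<And>x. cmod (u x) \<le> B"
  shows "integrable torus_measure u"
  using integrable_torus_bounded_mult [of "\<lambda>_. 1", OF _ assms] by simp

lemma torus_char_measurable [measurable]: "torus_char k \<in> borel_measurable torus_measure"
  by (intro continuous_measurable_torus continuous_intros)

lemma integrable_mult_torus_char:
  "integrable torus_measure F \<Longrightarrow> integrable torus_measure (\<lambda>x. F x * torus_char k x)"
  by (rule integrable_torus_bounded_mult [where B = 1]) auto

lemma integral_torus_char: "(\<integral>x. torus_char k x \<partial>torus_measure) = of_bool (k = 0)"
proof -
  let ?S = "{0..<1::real} \<times> {0..<1::real}"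
  have "integrable torus_measure (torus_char k)"
    by (rule integrable_torus_bounded [where B = 1]) auto
  then have "(\<integral>x. torus_char k x \<partial>torus_measure) = integral ?S (torus_char k)"
    unfolding torus_measure_def by (rule lebesgue_integral_eq_integral) simp
  also have "\<dots> = integral (cbox (0, 0) (1, 1)) (torus_char k)"
  \<comment> \<open>The half-open square lies between the open and the closed unit box, which differ
    only by the negligible frontier.\<close>
  proof (rule integral_spike_set)
    have "cbox (0, 0) (1, 1) - box (0, 0) (1::real, 1::real) \<in> null_sets lebesgue"
      using negligible_frontier_interval [of "(0, 0)" "(1::real, 1::real)"]
      by (simp add: negligible_iff_null_sets)
    then have neg: "negligible (cbox (0, 0) (1, 1) - box (0, 0) (1::real, 1::real))"
      by (simp add: negligible_iff_null_sets)
    have "box (0, 0) (1, 1) \<subseteq> ?S" "?S \<subseteq> cbox (0, 0) (1, 1)"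
      by (auto simp: box_prod cbox_Pair_eq)
    then show "negligible {x \<in> ?S - cbox (0, 0) (1, 1). torus_char k x \<noteq> 0}"
      "negligible {x \<in> cbox (0, 0) (1, 1) - ?S. torus_char k x \<noteq> 0}"
      by (auto intro!: negligible_subset [OF neg])
  qed
  also have "\<dots> = integral (cbox 0 1) (\<lambda>x. integral (cbox 0 1) (\<lambda>y. torus_char k (x, y)))"
    by (intro integral_prod_continuous continuous_intros)
  also have "\<dots> = integral {0..1} (\<lambda>x. integral {0..1} (\<lambda>y. torus_char (fst k, 0) (x, 0) * torus_char (0, snd k) (0, y)))"
    by (simp add: torus_char_1_2 [of k])
  also have "\<dots> = of_bool (fst k = 0) * of_bool (snd k = 0)"
    unfolding torus_char_def using integral_exp_period by simp
  also have "\<dots> = of_bool (k = 0)"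
    by (cases k) (auto simp: zero_prod_def)
  finally show ?thesis .
qed

section \<open>Completeness of the characters\<close>

text \<open>Integrability is part of the definition because the integral of a non-integrable
  function is 0 by default, which would make all its coefficients vanish.\<close>

definition null_coeffs :: "(real \<times> real \<Rightarrow> complex) \<Rightarrow> bool" where
  "null_coeffs F \<longleftrightarrow> integrable torus_measure F \<and> (\<forall>k. fourier_coeff F k = 0)"

text \<open>Multiplying by the character of frequency \<open>l\<close> only shifts the coefficients
  by \<open>l\<close>.\<close>

lemma null_coeffs_mult_char:
  assumes "null_coeffs F"
  shows "null_coeffs (\<lambda>x. F x * torus_char l x)"
proof -
  have "fourier_coeff (\<lambda>x. F x * torus_char l x) k = fourier_coeff F (k - l)" for k
    unfolding fourier_coeff_def by (simp add: mult.assoc torus_char_add [symmetric])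
  then show ?thesis
    using assms integrable_mult_torus_char unfolding null_coeffs_def by simp
qed

lemma null_coeffs_add:
  assumes "null_coeffs F" "null_coeffs G"
  shows "null_coeffs (\<lambda>x. F x + G x)"
  using assms integrable_mult_torus_char
  unfolding null_coeffs_def fourier_coeff_def by (simp add: distrib_right)

lemma null_coeffs_cmult:
  assumes "null_coeffs F"
  shows "null_coeffs (\<lambda>x. c * F x)"
  using assms unfolding null_coeffs_def fourier_coeff_def by (simp add: mult.assoc)

text \<open>Identifies the torus with the product of two unit circles, a compact subset of a
  Euclidean space, where Stone--Weierstrass for polynomial functions applies.\<close>

definition torus_embedding :: "real \<times> real \<Rightarrow> complex \<times> complex" where
  "torus_embedding x = (torus_char (1, 0) x, torus_char (0, 1) x)"

lemma cnj_torus_char: "cnj (torus_char k x) = torus_char (- k) x"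
  by (simp add: torus_char_def exp_cnj algebra_simps)

text \<open>The real part is half the sum of a character and its conjugate, which is the character
  of the opposite frequency.\<close>

lemma null_coeffs_mult_Re:
  assumes "null_coeffs F"
  shows "null_coeffs (\<lambda>x. F x * of_real (Re (torus_char k x)))"
proof -
  have "of_real (Re (torus_char k x)) = (torus_char k x + torus_char (- k) x) / 2" for x
    by (simp add: complex_add_cnj flip: cnj_torus_char)
  then have "(\<lambda>x. F x * of_real (Re (torus_char k x)))
      = (\<lambda>x. (1 / 2) * (F x * torus_char k x + F x * torus_char (- k) x))"
    by (simp add: fun_eq_iff field_simps)
  then show ?thesis
    by (simp only: assms null_coeffs_cmult null_coeffs_add null_coeffs_mult_char)
qed

lemma null_coeffs_mult_Im:
  assumes "null_coeffs F"
  shows "null_coeffs (\<lambda>x. F x * of_real (Im (torus_char k x)))"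
proof -
  \<comment> \<open>The difference is written as a sum with the factor \<open>(- 1)\<close> so that
    closure under sums and scalar multiples is all that is used.\<close>
  have Im: "of_real (Im (torus_char k x)) = (torus_char k x + (- 1) * torus_char (- k) x) / (2 * \<i>)" for x
    by (simp add: complex_diff_cnj complex_eq_iff flip: cnj_torus_char)
  have "(\<lambda>x. F x * of_real (Im (torus_char k x)))
      = (\<lambda>x. (1 / (2 * \<i>)) * (F x * torus_char k x + (- 1) * (F x * torus_char (- k) x)))"
    by (intro ext, simp only: Im, simp add: field_simps)
  then show ?thesis
    by (simp only: assms null_coeffs_cmult null_coeffs_add null_coeffs_mult_char)
qed

text \<open>Closure under multiplication is by iterating the multiplier property, so products of
  trigonometric polynomials never have to be expanded.\<close>

lemma null_coeffs_mult_polynomial: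
  assumes "real_polynomial_function p" "null_coeffs F"
  shows "null_coeffs (\<lambda>x. F x * of_real (p (torus_embedding x)))"
  using assms
proof (induction p arbitrary: F)
  case (linear p)
  interpret bounded_linear p by fact
  let ?e = "torus_char (1, 0)" and ?e' = "torus_char (0, 1)"
  \<comment> \<open>A real-linear map is determined by its values on the real basis
    \<open>(1, 0)\<close>, \<open>(\<i>, 0)\<close>, \<open>(0, 1)\<close>,
    \<open>(0, \<i>)\<close>. Hence \<open>p\<close> on the embedded torus is a combination of the
    real and imaginary parts of the two generating characters.\<close>
  have "p (torus_embedding x) = p (1, 0) * Re (?e x) + p (\<i>, 0) * Im (?e x)
      + p (0, 1) * Re (?e' x) + p (0, \<i>) * Im (?e' x)" for x
  proof -
    have "torus_embedding x = Re (?e x) *\<^sub>R (1, 0) + Im (?e x) *\<^sub>R (\<i>, 0)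
        + Re (?e' x) *\<^sub>R (0, 1) + Im (?e' x) *\<^sub>R (0, \<i>)"
      by (simp add: torus_embedding_def complex_eq_iff)
    then show ?thesis
      by (simp only: add scaleR) simp
  qed
  then have eq: "(\<lambda>x. F x * of_real (p (torus_embedding x))) =
    (\<lambda>x. of_real (p (1, 0)) * (F x * of_real (Re (?e x))) + of_real (p (\<i>, 0)) * (F x * of_real (Im (?e x)))
      + of_real (p (0, 1)) * (F x * of_real (Re (?e' x))) + of_real (p (0, \<i>)) * (F x * of_real (Im (?e' x))))"
    by (simp add: fun_eq_iff algebra_simps)
  show ?case
    unfolding eq
    by (rule null_coeffs_add null_coeffs_cmult null_coeffs_mult_Re null_coeffs_mult_Im linear.prems)+
next
  case (const c)
  then show ?case
    using null_coeffs_cmult [of F "of_real c"] by (simp add: mult.commute)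
next
  case (add p q)
  then show ?case
    using null_coeffs_add [OF add.IH(1) add.IH(2)] by (simp add: algebra_simps)
next
  case (mult p q)
  then show ?case
    using mult.IH(2) [OF mult.IH(1) [OF mult.prems]] by (simp add: mult.assoc)
qed

section \<open>Integrals against continuous functions on the product of circles\<close>

lemma torus_embedding_in: "torus_embedding x \<in> sphere 0 1 \<times> sphere 0 1"
  by (simp add: torus_embedding_def)

lemma continuous_on_torus_embedding: "continuous_on A torus_embedding"
  unfolding torus_embedding_def by (intro continuous_intros)

lemma continuous_bounded_on_torus:
  assumes "continuous_on UNIV (h :: complex \<times> complex \<Rightarrow> real)"
  obtains B where "\<And>x. \<bar>h (torus_embedding x)\<bar> \<le> B"
proof -
  have "compact (h ` (sphere 0 1 \<times> sphere 0 1))"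
    by (intro compact_continuous_image compact_Times compact_sphere continuous_on_subset [OF assms]) auto
  then obtain B where "\<forall>y\<in>h ` (sphere 0 1 \<times> sphere 0 1). norm y \<le> B"
    using compact_imp_bounded bounded_iff by metis
  then have "norm (h (torus_embedding x)) \<le> B" for x
    using imageI [OF torus_embedding_in, of h x] by (rule bspec)
  then show ?thesis
    by (intro that [of B]) simp
qed

lemma integrable_mult_continuous:
  fixes F :: "real \<times> real \<Rightarrow> complex"
  assumes "integrable torus_measure F" "continuous_on UNIV (h :: complex \<times> complex \<Rightarrow> real)"
  shows "integrable torus_measure (\<lambda>x. F x * of_real (h (torus_embedding x)))"
proof -
  obtain B where B: "\<And>x. \<bar>h (torus_embedding x)\<bar> \<le> B"
    using continuous_bounded_on_torus assms(2) by metis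
  have "continuous_on UNIV (\<lambda>x. h (torus_embedding x))"
    by (rule continuous_on_compose2 [OF assms(2) continuous_on_torus_embedding]) simp
  then have "(\<lambda>x. complex_of_real (h (torus_embedding x))) \<in> borel_measurable torus_measure"
    by (intro continuous_measurable_torus continuous_intros)
  then show ?thesis
    by (rule integrable_torus_bounded_mult [OF assms(1)]) (use B in \<open>simp add: norm_of_real\<close>)
qed

text \<open>On the product of circles, \<open>h\<close> is uniformly within \<open>d\<close> of a
  polynomial. The integral against the polynomial vanishes, and the replacement costs at most
  \<open>d\<close> times the L1 norm of \<open>F\<close>.\<close>

lemma integral_null_coeffs_mult_continuous:
  assumes F: "null_coeffs F" and h: "continuous_on UNIV (h :: complex \<times> complex \<Rightarrow> real)"
  shows "(\<integral>x. F x * of_real (h (torus_embedding x)) \<partial>torus_measure) = 0" (is "?I = 0")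
proof -
  let ?N = "\<integral>x. cmod (F x) \<partial>torus_measure"
  have int: "integrable torus_measure F"
    using F by (simp add: null_coeffs_def)
  have "cmod ?I \<le> e" if "e > 0" for e
  proof -
    have N: "?N \<ge> 0" by simp
    \<comment> \<open>Adding 1 keeps the denominator positive when the L1 norm of \<open>F\<close>
      is 0.\<close>
    define d where "d = e / (?N + 1)"
    have d: "d > 0" "d * ?N \<le> e"
      using that N by (auto simp: d_def field_simps add_pos_nonneg)
    obtain p where p: "real_polynomial_function p"
      "\<And>y. y \<in> sphere 0 1 \<times> sphere 0 1 \<Longrightarrow> \<bar>h y - p y\<bar> < d"
      using Stone_Weierstrass_real_polynomial_function [of "sphere 0 1 \<times> sphere 0 1" h d] d h
      by (metis compact_Times compact_sphere continuous_on_subset subset_UNIV)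
    have pc: "continuous_on UNIV p"
      using continuous_on_polymonial_function p(1) real_polynomial_function_eq by blast
    \<comment> \<open>The integral of \<open>F\<close> times the polynomial is the coefficient at
      frequency 0 of a function with null coefficients.\<close>
    have "fourier_coeff (\<lambda>x. F x * of_real (p (torus_embedding x))) 0 = 0"
      using null_coeffs_mult_polynomial [OF p(1) F] unfolding null_coeffs_def by blast
    then have "?I = (\<integral>x. F x * of_real (h (torus_embedding x) - p (torus_embedding x)) \<partial>torus_measure)"
      using integrable_mult_continuous [OF int h] integrable_mult_continuous [OF int pc]
      by (simp add: fourier_coeff_def right_diff_distrib)
    also have "cmod \<dots> \<le> (\<integral>x. cmod (F x * of_real (h (torus_embedding x) - p (torus_embedding x))) \<partial>torus_measure)"
      by (rule integral_norm_bound)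
    also have "\<dots> \<le> (\<integral>x. d * cmod (F x) \<partial>torus_measure)"
    proof (rule integral_mono)
      show "integrable torus_measure (\<lambda>x. cmod (F x * of_real (h (torus_embedding x) - p (torus_embedding x))))"
        using integrable_mult_continuous [OF int continuous_on_diff [OF h pc]] by (rule integrable_norm)
      show "cmod (F x * of_real (h (torus_embedding x) - p (torus_embedding x))) \<le> d * cmod (F x)" for x
        unfolding norm_mult norm_of_real
        using mult_right_mono [OF less_imp_le [OF p(2) [OF torus_embedding_in [of x]]] norm_ge_zero [of "F x"]]
        by (subst mult.commute)
    qed (use int in simp)
    also have "\<dots> \<le> e"
      using d by simp
    finally show ?thesis .
  qed
  then have "cmod ?I \<le> 0"
    by - (rule field_le_epsilon, simp)
  then show ?thesis by simp
qed

section \<open>From continuous test functions to compact sets and almost everywhere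
  vanishing\<close>

lemma exp_2pi_i_inj:
  assumes "exp (2 * of_real pi * \<i> * of_real s) = exp (2 * of_real pi * \<i> * of_real t)"
    "s \<in> {0..<1}" "t \<in> {0..<1::real}"
  shows "s = t"
proof -
  obtain n :: int where "2 * of_real pi * \<i> * of_real s = 2 * of_real pi * \<i> * of_real t + (of_int (2 * n) * pi) * \<i>"
    using assms(1) unfolding exp_eq by blast
  then have "2 * of_real pi * \<i> * of_real s = 2 * of_real pi * \<i> * of_real (t + of_int n)"
    by (simp add: algebra_simps)
  then have eq: "s = t + of_int n"
    by (simp only: mult_cancel_left of_real_eq_iff) simp
  then have "\<bar>real_of_int n\<bar> < 1"
    using assms(2,3) by auto
  then have "n = 0" by linarith
  then show ?thesis using eq by simp
qed

text \<open>The square must be half-open here: on the closed square, opposite edges have the same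
  image.\<close>

lemma inj_on_torus_embedding: "inj_on torus_embedding ({0..<1} \<times> {0..<1})"
proof (rule inj_onI)
  fix x y :: "real \<times> real"
  assume "x \<in> {0..<1} \<times> {0..<1}" "y \<in> {0..<1} \<times> {0..<1}" "torus_embedding x = torus_embedding y"
  then show "x = y"
    using exp_2pi_i_inj [of "fst x" "fst y"] exp_2pi_i_inj [of "snd x" "snd y"]
    by (auto simp: torus_embedding_def torus_char_def prod_eq_iff)
qed

text \<open>On the square, the indicator of \<open>K\<close> is a pointwise limit of continuous
  functions of the embedding with values in [0, 1], so dominated convergence with majorant
  \<open>cmod (F x)\<close> applies.\<close>

lemma integral_null_coeffs_compact:
  assumes F: "null_coeffs F" and K: "compact K" "K \<subseteq> {0..<1} \<times> {0..<1}"
  shows "(\<integral>x. F x * of_real (indicator K x) \<partial>torus_measure) = 0"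
\<comment> \<open>The empty set is treated apart: \<open>infdist\<close> to it is 0 by default, so
  the functions \<open>h n\<close> below would be constantly 1.\<close>
proof (cases "K = {}")
  case False
  define C where "C = torus_embedding ` K"
  \<comment> \<open>A tent function: 1 on \<open>C\<close>, falling linearly to 0 at distance
    \<open>1 / n\<close> from \<open>C\<close>.\<close>
  define h where "h n y = max 0 (1 - real n * infdist y C)" for n y
  have C: "compact C" "C \<noteq> {}"
    unfolding C_def using K False
    by (auto intro!: compact_continuous_image continuous_on_torus_embedding)
  have int: "integrable torus_measure F"
    using F by (simp add: null_coeffs_def)
  have hc: "continuous_on UNIV (h n)" for n
    unfolding h_def by (intro continuous_intros)
  have hb: "0 \<le> h n y" "h n y \<le> 1" for n y
    using infdist_nonneg [of y C] by (auto simp: h_def)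
  have lim: "(\<lambda>n. h n (torus_embedding x)) \<longlonglongrightarrow> indicator K x" if x: "x \<in> {0..<1} \<times> {0..<1}" for x
  proof (cases "x \<in> K")
    case True
    then have "h n (torus_embedding x) = 1" for n
      by (simp add: h_def C_def infdist_zero)
    then show ?thesis using True by simp
  next
    case False
    \<comment> \<open>By injectivity a point of the square outside \<open>K\<close> is not mapped
      into \<open>C\<close>. As \<open>C\<close> is closed, the distance is positive and
      \<open>h n\<close> vanishes there for all large \<open>n\<close>.\<close>
    have "torus_embedding x \<notin> C"
      unfolding C_def using inj_on_torus_embedding x K(2) False
      by (metis inj_on_image_mem_iff)
    then have pos: "infdist (torus_embedding x) C > 0"
      using C infdist_pos_not_in_closed compact_imp_closed by blast
    obtain N :: nat where N: "1 / infdist (torus_embedding x) C < real N"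
      using reals_Archimedean2 by blast
    have "eventually (\<lambda>n. h n (torus_embedding x) = 0) sequentially"
      using eventually_ge_at_top [of N]
    proof eventually_elim
      case (elim n)
      have "1 \<le> real N * infdist (torus_embedding x) C"
        using N pos by (simp add: field_simps)
      also have "\<dots> \<le> real n * infdist (torus_embedding x) C"
        using elim pos by (intro mult_right_mono) auto
      finally show ?case by (simp add: h_def)
    qed
    then show ?thesis
      using False by (simp add: tendsto_eventually)
  qed
  have meas: "F \<in> borel_measurable torus_measure"
    using int by (rule borel_measurable_integrable)
  have "K \<in> sets lebesgue"
    using K(1) by (simp add: borel_compact)
  then have Ks: "K \<in> sets torus_measure"
    using K(2) by (simp add: torus_measure_def sets_restrict_space_iff)
  have "(\<lambda>n. \<integral>x. F x * of_real (h n (torus_embedding x)) \<partial>torus_measure)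
      \<longlonglongrightarrow> (\<integral>x. F x * of_real (indicator K x) \<partial>torus_measure)"
  proof (rule integral_dominated_convergence [where w = "\<lambda>x. cmod (F x)"])
    show "(\<lambda>x. F x * of_real (indicator K x)) \<in> borel_measurable torus_measure"
      using meas Ks by measurable
    show "(\<lambda>x. F x * of_real (h n (torus_embedding x))) \<in> borel_measurable torus_measure" for n
      using integrable_mult_continuous [OF int hc] by (rule borel_measurable_integrable)
    show "AE x in torus_measure. (\<lambda>n. F x * of_real (h n (torus_embedding x))) \<longlonglongrightarrow> F x * of_real (indicator K x)"
      by (intro AE_I2 tendsto_intros lim) simp
    show "AE x in torus_measure. cmod (F x * of_real (h n (torus_embedding x))) \<le> cmod (F x)" for n
      using hb by (intro AE_I2) (simp add: norm_mult mult_left_le)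
  qed (use int in simp)
  then show ?thesis
    using integral_null_coeffs_mult_continuous [OF F hc] by (simp add: LIMSEQ_const_iff)
qed simp

text \<open>Inner regularity: closed subsets \<open>C\<close> exhaust the set \<open>A\<close> where
  the real part is positive, up to measure \<open>e\<close>. Each such \<open>C\<close> is compact,
  so the integral of \<open>F\<close> over it is 0. A positive integrand with integral 0 forces
  \<open>C\<close> to be null, and \<open>A\<close> has measure at most \<open>e\<close>.\<close>

lemma null_coeffs_Re_le_0:
  assumes F: "null_coeffs F"
  shows "AE x in torus_measure. Re (F x) \<le> 0"
proof -
  let ?T = "{0..<1::real} \<times> {0..<1::real}"
  define A where "A = {x \<in> space torus_measure. Re (F x) > 0}"
  have int: "integrable torus_measure F"
    using F by (simp add: null_coeffs_def)
  have meas: "F \<in> borel_measurable torus_measure"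
    using int by (rule borel_measurable_integrable)
  have As: "A \<in> sets torus_measure"
    unfolding A_def using meas by measurable
  have AT: "A \<subseteq> ?T" by (auto simp: A_def)
  have A: "A \<in> sets lebesgue"
    using As by (simp add: torus_measure_def sets_restrict_space_iff)
  have "emeasure lebesgue A \<le> ennreal e" if "e > 0" for e
  proof -
    obtain C where C: "closed C" "C \<subseteq> A" "A - C \<in> lmeasurable" "emeasure lebesgue (A - C) < ennreal e"
      using sets_lebesgue_inner_closed [OF A \<open>e > 0\<close>] .
    have "bounded ?T"
      by (intro bounded_Times) auto
    then have "compact C"
      using C(1,2) AT by (meson bounded_subset compact_eq_bounded_closed)
    then have Cl: "C \<in> sets lebesgue"
      by (simp add: borel_compact)
    then have Cs: "C \<in> sets torus_measure"
      using C(2) AT by (auto simp: torus_measure_def sets_restrict_space_iff)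
    have intC: "integrable torus_measure (\<lambda>x. F x * of_real (indicator C x))"
      using Cs by (intro integrable_torus_bounded_mult [where B = 1] int) (auto simp: indicator_def)
    have "(\<integral>x. F x * of_real (indicator C x) \<partial>torus_measure) = 0"
      using integral_null_coeffs_compact [OF F \<open>compact C\<close>] C(2) AT by blast
    then have "(\<integral>x. Re (F x * of_real (indicator C x)) \<partial>torus_measure) = 0"
      using integral_Re [OF intC] by simp
    moreover have "AE x in torus_measure. 0 \<le> Re (F x * of_real (indicator C x))"
      using C(2) by (intro AE_I2) (auto simp: A_def indicator_def)
    ultimately have "AE x in torus_measure. Re (F x * of_real (indicator C x)) = 0"
      using integral_nonneg_eq_0_iff_AE [OF integrable_Re [OF intC]] by blast
    then have "AE x in torus_measure. x \<notin> C"
      by eventually_elim (use C(2) in \<open>auto simp: A_def indicator_def split: if_splits\<close>)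
    then have "emeasure torus_measure C = 0"
      using Cs AE_iff_null_sets by auto
    then have "emeasure lebesgue C = 0"
      using C(2) AT by (simp add: torus_measure_def emeasure_restrict_space)
    moreover have "emeasure lebesgue A \<le> emeasure lebesgue (A - C) + emeasure lebesgue C"
      using emeasure_subadditive [of "A - C" lebesgue C] A Cl C(2) by (simp add: Un_absorb2)
    ultimately show ?thesis
      using C(4) by simp
  qed
  then have "emeasure lebesgue A \<le> 0"
    by - (rule ennreal_le_epsilon, simp)
  then have "emeasure lebesgue A = 0"
    by simp
  then have "A \<in> null_sets torus_measure"
    using As AT by (simp add: null_sets_def torus_measure_def emeasure_restrict_space)
  then have "AE x in torus_measure. x \<notin> A"
    by (rule AE_not_in)
  with AE_space [of torus_measure] show ?thesis
    by eventually_elim (auto simp: A_def)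
qed

text \<open>Rotating by 1, -1, \<open>\<i>\<close> and \<open>- \<i>\<close> turns the one-sided
  bound on the real part into both bounds on the real and imaginary parts.\<close>

lemma null_coeffs_AE_0:
  assumes F: "null_coeffs F"
  shows "AE x in torus_measure. F x = 0"
proof -
  have "AE x in torus_measure. Re (c * F x) \<le> 0" for c
    by (rule null_coeffs_Re_le_0 [OF null_coeffs_cmult [OF F]])
  from this [of 1] this [of "- 1"] this [of \<i>] this [of "- \<i>"]
  show ?thesis
    by eventually_elim (auto intro: complex_eqI)
qed

section \<open>Decay of the coefficients\<close>

text \<open>The mean value theorem for \<open>t powr (1 - \<beta>)\<close> between \<open>n\<close>
  and \<open>n + 1\<close> replaces the integral comparison, so that sums telescope.\<close>

lemma powr_neg_le_telescope:
  fixes \<beta> :: real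
  assumes "\<beta> > 1" "n \<ge> (1::nat)"
  shows "real n powr (- \<beta>) \<le> 2 powr \<beta> / (\<beta> - 1) * (real n powr (1 - \<beta>) - real (Suc n) powr (1 - \<beta>))"
proof -
  have "\<exists>t. real n < t \<and> t < real (Suc n) \<and>
      real (Suc n) powr (1 - \<beta>) - real n powr (1 - \<beta>) = (real (Suc n) - real n) * ((1 - \<beta>) * t powr (1 - \<beta> - 1))"
    using assms by (intro MVT2 has_real_derivative_powr) auto
  then obtain t where t: "real n < t" "t < real (Suc n)"
    "real (Suc n) powr (1 - \<beta>) - real n powr (1 - \<beta>) = (1 - \<beta>) * t powr (- \<beta>)"
    by auto
  \<comment> \<open>The factor \<open>2 powr \<beta>\<close> comes from
    \<open>t < n + 1 \<le> 2 * n\<close>.\<close>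
  have "real n powr (- \<beta>) = 2 powr \<beta> * (2 * real n) powr (- \<beta>)"
    by (simp add: powr_mult powr_minus)
  also have "\<dots> \<le> 2 powr \<beta> * t powr (- \<beta>)"
    using t assms by (intro mult_left_mono powr_mono2') auto
  also have "t powr (- \<beta>) = (real n powr (1 - \<beta>) - real (Suc n) powr (1 - \<beta>)) / (\<beta> - 1)"
    using t(3) assms(1) by (simp add: field_simps)
  finally show ?thesis by simp
qed

text \<open>Telescoping from the least integer above \<open>N\<close>. The cutoff \<open>L\<close>
  keeps the sum finite, and the bound is uniform in it.\<close>

lemma sum_powr_tail_le:
  fixes \<beta> N :: real
  assumes "\<beta> > 1" "N > 0"
  shows "(\<Sum>n\<in>{n. N \<le> real n \<and> n \<le> L}. real n powr (- \<beta>)) \<le> 2 powr \<beta> / (\<beta> - 1) * N powr (1 - \<beta>)"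
proof -
  define n0 where "n0 = nat \<lceil>N\<rceil>"
  define K where "K = 2 powr \<beta> / (\<beta> - 1)"
  have n0: "n0 \<ge> 1" "N \<le> real n0" and K: "K \<ge> 0"
    using assms by (auto simp: n0_def K_def le_nat_iff real_nat_ceiling_ge)
  have set: "{n. N \<le> real n \<and> n \<le> L} = {n0..L}"
    unfolding n0_def by (auto simp: nat_le_iff ceiling_le_iff)
  have "(\<Sum>n\<in>{n0..L}. real n powr (- \<beta>)) \<le> K * N powr (1 - \<beta>)"
  proof (cases "n0 \<le> L")
    case True
    have "(\<Sum>n\<in>{n0..L}. real n powr (- \<beta>))
        \<le> (\<Sum>n\<in>{n0..L}. K * (real n powr (1 - \<beta>) - real (Suc n) powr (1 - \<beta>)))"
      using n0 assms(1) unfolding K_def by (intro sum_mono powr_neg_le_telescope) auto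
    also have "\<dots> = K * - (\<Sum>n\<in>{n0..L}. real (Suc n) powr (1 - \<beta>) - real n powr (1 - \<beta>))"
      by (simp add: sum_distrib_left [symmetric] sum_negf [symmetric] del: of_nat_Suc)
    also have "\<dots> = K * (real n0 powr (1 - \<beta>) - real (Suc L) powr (1 - \<beta>))"
      using sum_Suc_diff [of n0 L "\<lambda>n. real n powr (1 - \<beta>)"] True by (simp del: of_nat_Suc)
    also have "\<dots> \<le> K * real n0 powr (1 - \<beta>)"
      using K by (intro mult_left_mono) auto
    also have "\<dots> \<le> K * N powr (1 - \<beta>)"
      using K n0 assms by (intro mult_left_mono powr_mono2') auto
    finally show ?thesis .
  qed (use K in auto)
  then show ?thesis
    unfolding set K_def .
qed

section \<open>Reciprocal weights and their tails\<close>

definition weight1 :: "real \<Rightarrow> int \<Rightarrow> real" where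
  "weight1 \<alpha> m = (1 + \<bar>real_of_int m\<bar>\<^sup>2) powr \<alpha>"

lemma mix_weight_eq: "mix_weight \<alpha> k = weight1 \<alpha> (fst k) * weight1 \<alpha> (snd k)"
  by (simp add: mix_weight_def weight1_def)

lemma weight1_pos: "weight1 \<alpha> m > 0"
proof -
  have "1 + \<bar>real_of_int m\<bar>\<^sup>2 > 0"
    by (intro add_pos_nonneg) auto
  then show ?thesis
    unfolding weight1_def by simp
qed

lemma inverse_weight1_le:
  assumes "m \<noteq> 0" "\<alpha> > 0"
  shows "inverse (weight1 \<alpha> m) \<le> real (nat \<bar>m\<bar>) powr (- (2 * \<alpha>))"
proof -
  have "inverse (weight1 \<alpha> m) = (1 + \<bar>real_of_int m\<bar>\<^sup>2) powr (- \<alpha>)"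
    by (simp add: weight1_def powr_minus)
  also have "\<dots> \<le> (\<bar>real_of_int m\<bar>\<^sup>2) powr (- \<alpha>)"
    using assms by (intro powr_mono2') auto
  also have "\<dots> = \<bar>real_of_int m\<bar> powr (- (2 * \<alpha>))"
    using assms powr_powr [of "\<bar>real_of_int m\<bar>" 2 "- \<alpha>"] by simp
  finally show ?thesis by simp
qed

text \<open>Positivity of \<open>N\<close> excludes frequency 0. The remaining frequencies are
  \<open>n\<close> and \<open>- n\<close> with \<open>n > 0\<close>, whence the factor 2.\<close>

lemma sum_inverse_weight1_tail_le:
  assumes "\<alpha> > 1/2" "N > 0"
  shows "(\<Sum>m\<in>{m. N \<le> \<bar>real_of_int m\<bar> \<and> \<bar>m\<bar> \<le> int L}. inverse (weight1 \<alpha> m))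
    \<le> 2 * (2 powr (2 * \<alpha>) / (2 * \<alpha> - 1)) * N powr (1 - 2 * \<alpha>)"
proof -
  let ?P = "{n. N \<le> real n \<and> n \<le> L}"
  let ?u = "\<lambda>n. real n powr (- (2 * \<alpha>))"
  have fin: "finite ?P"
    by (rule finite_subset [of _ "{..L}"]) auto
  have pos: "n > 0" if "n \<in> ?P" for n
    using that assms by (cases n) auto
  have "{m. N \<le> \<bar>real_of_int m\<bar> \<and> \<bar>m\<bar> \<le> int L} = int ` ?P \<union> (\<lambda>n. - int n) ` ?P" (is "?A = _")
  proof (intro equalityI subsetI)
    fix m assume m: "m \<in> ?A"
    then have "nat \<bar>m\<bar> \<in> ?P" by auto
    moreover have "m = int (nat \<bar>m\<bar>) \<or> m = - int (nat \<bar>m\<bar>)" by auto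
    ultimately show "m \<in> int ` ?P \<union> (\<lambda>n. - int n) ` ?P" by blast
  qed auto
  then have "(\<Sum>m\<in>?A. inverse (weight1 \<alpha> m))
      \<le> (\<Sum>m\<in>int ` ?P. inverse (weight1 \<alpha> m)) + (\<Sum>m\<in>(\<lambda>n. - int n) ` ?P. inverse (weight1 \<alpha> m))"
    using fin weight1_pos [of \<alpha>]
    by (simp add: sum_Un less_imp_le sum_nonneg)
  also have "\<dots> = (\<Sum>n\<in>?P. inverse (weight1 \<alpha> (int n))) + (\<Sum>n\<in>?P. inverse (weight1 \<alpha> (- int n)))"
    by (simp add: sum.reindex inj_on_def)
  also have "\<dots> \<le> (\<Sum>n\<in>?P. ?u n) + (\<Sum>n\<in>?P. ?u n)"
  proof (intro add_mono sum_mono)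
    fix n assume "n \<in> ?P"
    then have "int n \<noteq> 0" using pos by force
    then show "inverse (weight1 \<alpha> (int n)) \<le> ?u n" "inverse (weight1 \<alpha> (- int n)) \<le> ?u n"
      using inverse_weight1_le [of "int n" \<alpha>] inverse_weight1_le [of "- int n" \<alpha>] assms by auto
  qed
  also have "\<dots> \<le> 2 * (2 powr (2 * \<alpha>) / (2 * \<alpha> - 1) * N powr (1 - 2 * \<alpha>))"
    using sum_powr_tail_le [of "2 * \<alpha>" N L] assms by simp
  finally show ?thesis by simp
qed

lemma sum_inverse_weight1_le:
  assumes "\<alpha> > 1/2"
  shows "(\<Sum>m\<in>{-int L..int L}. inverse (weight1 \<alpha> m)) \<le> 1 + 2 * (2 powr (2 * \<alpha>) / (2 * \<alpha> - 1))"
proof -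
  let ?A = "{m. 1 \<le> \<bar>real_of_int m\<bar> \<and> \<bar>m\<bar> \<le> int L}"
  have fin: "finite ?A"
    by (rule finite_subset [of _ "{-int L..int L}"]) auto
  have "{-int L..int L} = insert 0 ?A"
    by auto
  then have "(\<Sum>m\<in>{-int L..int L}. inverse (weight1 \<alpha> m)) = inverse (weight1 \<alpha> 0) + (\<Sum>m\<in>?A. inverse (weight1 \<alpha> m))"
    using fin by simp
  then show ?thesis
    using sum_inverse_weight1_tail_le [OF assms, of 1 L] by (simp add: weight1_def)
qed

text \<open>With \<open>K = 2 powr (2 * \<alpha>) / (2 * \<alpha> - 1)\<close> this is
  \<open>2 * (2 * K) * (1 + 2 * K)\<close>: two choices of the large coordinate, the tail constant
  for that coordinate, and the bound on the full sum over the other.\<close>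

definition tail_const :: "real \<Rightarrow> real" where
  "tail_const \<alpha> = 2 * (2 * (2 powr (2 * \<alpha>) / (2 * \<alpha> - 1))) * (1 + 2 * (2 powr (2 * \<alpha>) / (2 * \<alpha> - 1)))"

lemma tail_const_pos: "\<alpha> > 1/2 \<Longrightarrow> tail_const \<alpha> > 0"
  unfolding tail_const_def by (intro mult_pos_pos add_pos_pos divide_pos_pos) auto

text \<open>\<open>F\<close> is covered by two products, each of a one-dimensional tail
  \<open>A\<close> with a full interval \<open>B\<close>. The weight is a product, so each of the
  two sums factorises.\<close>

lemma sum_inverse_mix_weight_tail_le:
  assumes "\<alpha> > 1/2" "N > 0" "finite F"
    and F: "\<And>k. k \<in> F \<Longrightarrow> N \<le> \<bar>real_of_int (fst k)\<bar> \<or> N \<le> \<bar>real_of_int (snd k)\<bar>"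
  shows "(\<Sum>k\<in>F. inverse (mix_weight \<alpha> k)) \<le> tail_const \<alpha> * N powr (1 - 2 * \<alpha>)"
proof -
  define K where "K = 2 powr (2 * \<alpha>) / (2 * \<alpha> - 1)"
  \<comment> \<open>A crude bound for all coordinates occurring in \<open>F\<close>; the final
    estimate does not involve \<open>L\<close>.\<close>
  define L where "L = nat (\<Sum>k\<in>F. \<bar>fst k\<bar> + \<bar>snd k\<bar>)"
  define A where "A = {m. N \<le> \<bar>real_of_int m\<bar> \<and> \<bar>m\<bar> \<le> int L}"
  define B where "B = {-int L..int L}"
  let ?u = "\<lambda>m. inverse (weight1 \<alpha> m)"
  have "A \<subseteq> B"
    by (auto simp: A_def B_def)
  then have fin: "finite A" "finite B"
    by (auto simp: B_def intro: finite_subset)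
  have nn: "?u m \<ge> 0" for m
    using weight1_pos [of \<alpha> m] by simp
  have FL: "\<bar>fst k\<bar> + \<bar>snd k\<bar> \<le> int L" if "k \<in> F" for k
  proof -
    have "\<bar>fst k\<bar> + \<bar>snd k\<bar> \<le> (\<Sum>k\<in>F. \<bar>fst k\<bar> + \<bar>snd k\<bar>)"
      using that assms(3) by (intro member_le_sum) auto
    then show ?thesis unfolding L_def by linarith
  qed
  have "F \<subseteq> A \<times> B \<union> B \<times> A"
  proof
    fix k assume k: "k \<in> F"
    show "k \<in> A \<times> B \<union> B \<times> A"
      using F [OF k] FL [OF k] by (cases k) (auto simp: A_def B_def)
  qed
  then have "(\<Sum>k\<in>F. inverse (mix_weight \<alpha> k)) \<le> (\<Sum>k\<in>A \<times> B \<union> B \<times> A. ?u (fst k) * ?u (snd k))"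
    using fin nn unfolding mix_weight_eq inverse_mult_distrib by (intro sum_mono2) auto
  also have "\<dots> \<le> (\<Sum>k\<in>A \<times> B. ?u (fst k) * ?u (snd k)) + (\<Sum>k\<in>B \<times> A. ?u (fst k) * ?u (snd k))"
    using fin nn by (simp add: sum_Un sum_nonneg)
  also have "\<dots> = 2 * (sum ?u A * sum ?u B)"
    using sum.swap [of "\<lambda>x y. ?u x * ?u y" A B]
    by (simp add: sum_product sum.cartesian_product' mult.commute)
  also have "\<dots> \<le> 2 * ((2 * K * N powr (1 - 2 * \<alpha>)) * (1 + 2 * K))"
    using assms nn sum_inverse_weight1_tail_le [OF assms(1,2)] sum_inverse_weight1_le [OF assms(1)]
    unfolding A_def B_def K_def
    by (intro mult_left_mono mult_mono) (auto intro!: sum_nonneg mult_nonneg_nonneg)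
  finally show ?thesis
    by (simp add: K_def tail_const_def mult_ac)
qed

text \<open>Cauchy--Schwarz after splitting \<open>cmod (a k)\<close> into
  \<open>cmod (a k) * sqrt (mix_weight \<alpha> k)\<close> and the reciprocal root of the
  weight.\<close>

lemma sum_norm_tail_le:
  fixes a :: "int \<times> int \<Rightarrow> complex"
  assumes "\<alpha> > 1/2" "N > 0" "finite F"
    and F: "\<And>k. k \<in> F \<Longrightarrow> N \<le> \<bar>real_of_int (fst k)\<bar> \<or> N \<le> \<bar>real_of_int (snd k)\<bar>"
    and summable: "(\<lambda>k. (cmod (a k))\<^sup>2 * mix_weight \<alpha> k) summable_on UNIV"
  shows "(\<Sum>k\<in>F. cmod (a k))
    \<le> sqrt (\<Sum>\<^sub>\<infinity>k. (cmod (a k))\<^sup>2 * mix_weight \<alpha> k) * sqrt (tail_const \<alpha> * N powr (1 - 2 * \<alpha>))"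
proof -
  have w: "mix_weight \<alpha> k > 0" for k
    unfolding mix_weight_eq by (intro mult_pos_pos weight1_pos)
  let ?b = "\<lambda>k. cmod (a k) * sqrt (mix_weight \<alpha> k)"
  let ?c = "\<lambda>k. sqrt (inverse (mix_weight \<alpha> k))"
  have eq: "cmod (a k) = \<bar>?b k\<bar> * \<bar>?c k\<bar>" for k
    using w [of k] by (simp add: real_sqrt_inverse abs_mult)
  have "(\<Sum>k\<in>F. cmod (a k)) = (\<Sum>k\<in>F. \<bar>?b k\<bar> * \<bar>?c k\<bar>)"
    by (intro sum.cong refl eq)
  also have "\<dots> \<le> L2_set ?b F * L2_set ?c F"
    by (rule L2_set_mult_ineq)
  also have "L2_set ?b F = sqrt (\<Sum>k\<in>F. (cmod (a k))\<^sup>2 * mix_weight \<alpha> k)"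
    using w by (simp add: L2_set_def power_mult_distrib less_imp_le)
  also have "L2_set ?c F = sqrt (\<Sum>k\<in>F. inverse (mix_weight \<alpha> k))"
    using w by (simp add: L2_set_def less_imp_le)
  also have "sqrt (\<Sum>k\<in>F. (cmod (a k))\<^sup>2 * mix_weight \<alpha> k) * sqrt (\<Sum>k\<in>F. inverse (mix_weight \<alpha> k))
      \<le> sqrt (\<Sum>\<^sub>\<infinity>k. (cmod (a k))\<^sup>2 * mix_weight \<alpha> k) * sqrt (tail_const \<alpha> * N powr (1 - 2 * \<alpha>))"
    using w assms(3)
    by (intro mult_mono real_sqrt_le_mono finite_sum_le_infsum summable
        sum_inverse_mix_weight_tail_le assms F)
      (auto intro!: sum_nonneg infsum_nonneg mult_nonneg_nonneg simp: less_imp_le)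
  finally show ?thesis .
qed

text \<open>A nonzero frequency has a coordinate of absolute value at least 1, so the tail estimate
  with \<open>N = 1\<close> bounds every finite sum away from the origin.\<close>

lemma abs_summable_of_mix_weighted:
  fixes a :: "int \<times> int \<Rightarrow> complex"
  assumes "\<alpha> > 1/2" and summable: "(\<lambda>k. (cmod (a k))\<^sup>2 * mix_weight \<alpha> k) summable_on UNIV"
  shows "(\<lambda>k. cmod (a k)) summable_on UNIV"
proof -
  define B where "B = sqrt (\<Sum>\<^sub>\<infinity>k. (cmod (a k))\<^sup>2 * mix_weight \<alpha> k) * sqrt (tail_const \<alpha> * 1 powr (1 - 2 * \<alpha>))"
  have "(\<lambda>k. cmod (a k)) summable_on (UNIV - {0})"
  proof (rule nonneg_bdd_above_summable_on)
    show "bdd_above (sum (\<lambda>k. cmod (a k)) ` {F. F \<subseteq> UNIV - {0} \<and> finite F})"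
    proof (rule bdd_aboveI2)
      fix F assume F: "F \<in> {F. F \<subseteq> UNIV - {0::int \<times> int} \<and> finite F}"
      have "1 \<le> \<bar>real_of_int (fst k)\<bar> \<or> 1 \<le> \<bar>real_of_int (snd k)\<bar>" if "k \<in> F" for k
      proof -
        have "fst k \<noteq> 0 \<or> snd k \<noteq> 0"
          using that F by (cases k) (auto simp: zero_prod_def)
        then show ?thesis by auto
      qed
      then show "(\<Sum>k\<in>F. cmod (a k)) \<le> B"
        unfolding B_def using F by (intro sum_norm_tail_le assms) auto
    qed
  qed auto
  then have "(\<lambda>k. cmod (a k)) summable_on (insert 0 (UNIV - {0}))"
    by (subst summable_on_insert_iff) auto
  then show ?thesis
    by (simp add: insert_absorb)
qed

section \<open>Absolutely convergent Fourier series\<close>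

definition fourier_series :: "(int \<times> int \<Rightarrow> complex) \<Rightarrow> real \<times> real \<Rightarrow> complex" where
  "fourier_series a x = (\<Sum>\<^sub>\<infinity>k. a k * torus_char k x)"

lemma fourier_series_has_sum:
  assumes "(\<lambda>k. cmod (a k)) summable_on UNIV"
  shows "((\<lambda>k. a k * torus_char k x) has_sum fourier_series a x) UNIV"
  unfolding fourier_series_def
  by (rule has_sum_infsum, rule abs_summable_summable) (use assms in \<open>simp add: norm_mult\<close>)

lemma fourier_series_uniform_limit:
  assumes "(\<lambda>k. cmod (a k)) summable_on UNIV"
  shows "uniform_limit UNIV (\<lambda>F x. \<Sum>k\<in>F. a k * torus_char k x) (fourier_series a) (finite_subsets_at_top UNIV)"
  unfolding fourier_series_def
  by (rule Weierstrass_m_test_general [OF _ assms]) (simp add: norm_mult)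

lemma continuous_on_fourier_series:
  assumes "(\<lambda>k. cmod (a k)) summable_on UNIV"
  shows "continuous_on UNIV (fourier_series a)"
  by (rule uniform_limit_theorem [OF _ fourier_series_uniform_limit [OF assms]])
    (auto intro!: always_eventually continuous_intros)

lemma periodic_fourier_series: "periodic_fun2 (fourier_series a)"
  using periodic_torus_char unfolding periodic_fun2_def fourier_series_def by simp

lemma norm_fourier_series_le:
  assumes "(\<lambda>k. cmod (a k)) summable_on UNIV"
  shows "cmod (fourier_series a x) \<le> (\<Sum>\<^sub>\<infinity>k. cmod (a k))"
  by (rule norm_has_sum_bound [OF _ fourier_series_has_sum [OF assms]])
    (use assms in \<open>simp add: norm_mult\<close>)

lemma integrable_fourier_series:
  assumes "(\<lambda>k. cmod (a k)) summable_on UNIV"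
  shows "integrable torus_measure (fourier_series a)"
  using norm_fourier_series_le [OF assms] continuous_on_fourier_series [OF assms]
  by (intro integrable_torus_bounded continuous_measurable_torus)

lemma fourier_coeff_diff:
  assumes "integrable torus_measure f" "integrable torus_measure g"
  shows "fourier_coeff (\<lambda>x. f x - g x) k = fourier_coeff f k - fourier_coeff g k"
  unfolding fourier_coeff_def left_diff_distrib
  by (intro Bochner_Integration.integral_diff integrable_mult_torus_char assms)

lemma fourier_coeff_trig_poly:
  assumes "finite F"
  shows "fourier_coeff (\<lambda>x. \<Sum>l\<in>F. a l * torus_char l x) k = (if k \<in> F then a k else 0)"
proof -
  have "fourier_coeff (\<lambda>x. \<Sum>l\<in>F. a l * torus_char l x) k
      = (\<integral>x. (\<Sum>l\<in>F. a l * torus_char (l - k) x) \<partial>torus_measure)"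
    unfolding fourier_coeff_def
    by (simp add: sum_distrib_right mult.assoc torus_char_add [symmetric])
  also have "\<dots> = (\<Sum>l\<in>F. a l * of_bool (l = k))"
    using integrable_torus_bounded [of "torus_char _" 1]
    by (simp add: integral_torus_char)
  also have "\<dots> = (if k \<in> F then a k else 0)"
    using assms by simp
  finally show ?thesis .
qed

text \<open>A partial sum whose index set contains \<open>k\<close> has \<open>k\<close>-th
  coefficient \<open>a k\<close>. Since the torus has measure 1, a uniform error below
  \<open>e\<close> changes a coefficient by at most \<open>e\<close>.\<close>

lemma fourier_coeff_fourier_series:
  assumes "(\<lambda>k. cmod (a k)) summable_on UNIV"
  shows "fourier_coeff (fourier_series a) k = a k"
proof -
  have "cmod (a k - fourier_coeff (fourier_series a) k) \<le> e" if "e > 0" for e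
  proof -
    let ?p = "\<lambda>F x. \<Sum>k\<in>F. a k * torus_char k x"
    have "eventually (\<lambda>F. \<forall>x\<in>UNIV. dist (?p F x) (fourier_series a x) < e) (finite_subsets_at_top UNIV)"
      using uniform_limitD [OF fourier_series_uniform_limit [OF assms] that] .
    moreover have "eventually (\<lambda>F. finite F \<and> {k} \<subseteq> F \<and> F \<subseteq> UNIV) (finite_subsets_at_top UNIV)"
      unfolding eventually_finite_subsets_at_top by (intro exI [of _ "{k}"]) auto
    ultimately have "eventually (\<lambda>F. finite F \<and> k \<in> F \<and> (\<forall>x. cmod (?p F x - fourier_series a x) < e))
        (finite_subsets_at_top UNIV)"
      by eventually_elim (auto simp: dist_norm)
    from eventually_happens' [OF finite_subsets_at_top_neq_bot this]
    obtain F where F: "finite F" "k \<in> F" "\<And>x. cmod (?p F x - fourier_series a x) < e"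
      by auto
    have int: "integrable torus_measure (?p F)"
      using integrable_torus_bounded [of "torus_char _" 1] by simp
    have diff: "integrable torus_measure (\<lambda>x. (?p F x - fourier_series a x) * torus_char (- k) x)"
      using int integrable_fourier_series [OF assms]
      by (intro integrable_mult_torus_char Bochner_Integration.integrable_diff)
    have "a k - fourier_coeff (fourier_series a) k = fourier_coeff (?p F) k - fourier_coeff (fourier_series a) k"
      using F by (simp add: fourier_coeff_trig_poly)
    also have "\<dots> = (\<integral>x. (?p F x - fourier_series a x) * torus_char (- k) x \<partial>torus_measure)"
      using fourier_coeff_diff [OF int integrable_fourier_series [OF assms], of k]
      by (simp add: fourier_coeff_def)
    also have "cmod \<dots> \<le> (\<integral>x. cmod ((?p F x - fourier_series a x) * torus_char (- k) x) \<partial>torus_measure)"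
      by (rule integral_norm_bound)
    also have "\<dots> \<le> (\<integral>x. e \<partial>torus_measure)"
      using F(3) by (intro integral_mono integrable_norm diff) (auto simp: norm_mult less_imp_le)
    also have "\<dots> = e"
      using torus.prob_space by simp
    finally show ?thesis .
  qed
  then have "cmod (a k - fourier_coeff (fourier_series a) k) \<le> 0"
    by - (rule field_le_epsilon, simp)
  then show ?thesis by simp
qed

section \<open>The continuous representative\<close>

lemma periodic_fun2_of_nat:
  assumes "periodic_fun2 f"
  shows "f (x + real m, y + real n) = f (x, y)"
proof -
  have "f (x + real m, y) = f (x, y)" for x y
    using assms by (induction m arbitrary: x) (auto simp: periodic_fun2_def add.assoc [symmetric])
  moreover have "f (x, y + real n) = f (x, y)" for x y
    using assms by (induction n arbitrary: y) (auto simp: periodic_fun2_def add.assoc [symmetric])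
  ultimately show ?thesis by simp
qed

lemma periodic_fun2_of_int:
  assumes "periodic_fun2 f"
  shows "f (x + of_int m, y + of_int n) = f (x, y)"
proof -
  \<comment> \<open>Negative shifts are moved to the other side through
    \<open>m + nat (- m) = nat m\<close>, which leaves only natural shifts.\<close>
  have "f (x + of_int m + real (nat (- m)), y + of_int n + real (nat (- n))) =
      f (x + real (nat m), y + real (nat n))"
    by (intro arg_cong [of _ _ f]) (auto simp: prod_eq_iff)
  then show ?thesis
    by (simp only: periodic_fun2_of_nat [OF assms])
qed

lemma periodic_fun2_frac:
  assumes "periodic_fun2 f"
  shows "f (frac x, frac y) = f (x, y)"
  using periodic_fun2_of_int [OF assms, of "frac x" "\<lfloor>x\<rfloor>" "frac y" "\<lfloor>y\<rfloor>"] by (simp add: frac_def)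

text \<open>Inside the open unit box the set of disagreement is open and null, hence empty.
  Continuity extends the equality to the closed box, and periodicity to the plane.\<close>

lemma periodic_continuous_AE_eq:
  assumes "continuous_on UNIV g" "periodic_fun2 g" "continuous_on UNIV h" "periodic_fun2 h"
    and AE: "AE x in torus_measure. g x = h x"
  shows "g = h"
proof -
  let ?T = "{0..<1::real} \<times> {0..<1::real}"
  define U where "U = {x. g x \<noteq> h x} \<inter> box (0, 0) (1, 1)"
  have "open U"
    unfolding U_def using assms by (intro open_Int open_Collect_neq open_box)
  have UT: "U \<subseteq> ?T"
    by (auto simp: U_def box_prod)
  have U: "U \<in> sets lebesgue"
    using \<open>open U\<close> by simp
  then have Us: "U \<in> sets torus_measure"
    using UT by (simp add: torus_measure_def sets_restrict_space_iff)
  have "AE x in torus_measure. x \<notin> U"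
    using AE by eventually_elim (simp add: U_def)
  then have "emeasure torus_measure U = 0"
    using Us AE_iff_null_sets by auto
  then have "negligible U"
    using U UT by (simp add: negligible_iff_null_sets null_sets_def torus_measure_def emeasure_restrict_space)
  then have "U = {}"
    using \<open>open U\<close> open_not_negligible by blast
  then have "box (0, 0) (1, 1) \<subseteq> {x. g x = h x}"
    by (auto simp: U_def)
  moreover have "closed {x. g x = h x}"
    using assms by (intro closed_Collect_eq)
  ultimately have "closure (box (0, 0) (1, 1)) \<subseteq> {x. g x = h x}"
    by (rule closure_minimal)
  moreover have "closure (box (0, 0) (1::real, 1::real)) = cbox (0, 0) (1, 1)"
    by (rule closure_box) (simp add: box_prod)
  ultimately have eq: "g x = h x" if "x \<in> cbox (0, 0) (1, 1)" for x
    using that by blast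
  show ?thesis
  proof
    fix x :: "real \<times> real"
    have "(frac (fst x), frac (snd x)) \<in> cbox (0, 0) (1, 1)"
      by (simp add: cbox_Pair_eq less_imp_le [OF frac_lt_1])
    from eq [OF this] show "g x = h x"
      using periodic_fun2_frac [OF assms(2), of "fst x" "snd x"]
        periodic_fun2_frac [OF assms(4), of "fst x" "snd x"] by simp
  qed
qed

text \<open>On a space of finite measure, \<open>1 + (cmod (f x))\<^sup>2\<close> is an integrable
  majorant.\<close>

lemma integrable_L2_torus:
  assumes "f \<in> L2_torus"
  shows "integrable torus_measure f"
proof (rule Bochner_Integration.integrable_bound)
  show "integrable torus_measure (\<lambda>x. 1 + (cmod (f x))\<^sup>2)"
    using assms by (simp add: L2_torus_def)
  show "AE x in torus_measure. cmod (f x) \<le> norm (1 + (cmod (f x))\<^sup>2)"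
  proof (rule AE_I2)
    fix x
    have "0 \<le> (cmod (f x) - 1)\<^sup>2" by simp
    then have "cmod (f x) \<le> 1 + (cmod (f x))\<^sup>2"
      unfolding power2_diff by (simp add: field_simps) (smt (verit) norm_ge_zero)
    then show "cmod (f x) \<le> norm (1 + (cmod (f x))\<^sup>2)"
      by simp
  qed
qed (use assms in \<open>simp add: L2_torus_def\<close>)

lemma Hmix_abs_summable:
  assumes "\<alpha> > 1/2" "f \<in> Hmix \<alpha>"
  shows "(\<lambda>k. cmod (fourier_coeff f k)) summable_on UNIV"
  using assms by (intro abs_summable_of_mix_weighted [of \<alpha>]) (auto simp: Hmix_def)

text \<open>The difference of \<open>f\<close> and its Fourier series has only zero coefficients, so
  completeness applies.\<close>

lemma Hmix_AE_fourier_series: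
  assumes "\<alpha> > 1/2" "f \<in> Hmix \<alpha>"
  shows "AE x in torus_measure. f x = fourier_series (fourier_coeff f) x"
proof -
  let ?g = "fourier_series (fourier_coeff f)"
  note summable = Hmix_abs_summable [OF assms]
  have f: "integrable torus_measure f"
    using assms by (intro integrable_L2_torus) (simp add: Hmix_def)
  have g: "integrable torus_measure ?g"
    by (rule integrable_fourier_series [OF summable])
  have "null_coeffs (\<lambda>x. f x - ?g x)"
    using f g fourier_coeff_fourier_series [OF summable] by (simp add: null_coeffs_def fourier_coeff_diff)
  from null_coeffs_AE_0 [OF this] show ?thesis
    by eventually_elim simp
qed

text \<open>The Fourier series is a witness for the choice operator, and uniqueness of continuous
  periodic representatives identifies the chosen function with it.\<close>

lemma continuous_rep_Hmix:
  assumes "\<alpha> > 1/2" "f \<in> Hmix \<alpha>"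
  shows "continuous_rep f = fourier_series (fourier_coeff f)"
proof -
  let ?g = "fourier_series (fourier_coeff f)"
  let ?P = "\<lambda>g. continuous_on UNIV g \<and> periodic_fun2 g \<and> (AE x in torus_measure. g x = f x)"
  note summable = Hmix_abs_summable [OF assms]
  have AE: "AE x in torus_measure. ?g x = f x"
    using Hmix_AE_fourier_series [OF assms] by eventually_elim simp
  then have g: "?P ?g"
    using continuous_on_fourier_series [OF summable] periodic_fourier_series by blast
  then have rep: "?P (continuous_rep f)"
    unfolding continuous_rep_def by (rule someI [of ?P])
  then have "AE x in torus_measure. continuous_rep f x = f x"
    by (elim conjE)
  with AE have "AE x in torus_measure. continuous_rep f x = ?g x"
    by eventually_elim simp
  with rep g show ?thesis
    by (elim conjE) (rule periodic_continuous_AE_eq)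
qed

section \<open>Aliasing on reconstructing lattices\<close>

lemma torus_char_lattice_node:
  "torus_char k (lattice_node z M j) = exp (2 * of_real pi * \<i> * of_int (fst k * fst z + snd k * snd z) * of_nat j / of_nat M)"
  unfolding torus_char_def lattice_node_def
  by (intro arg_cong [of _ _ exp]) (simp add: algebra_simps add_divide_distrib)

text \<open>The inner products of \<open>k\<close> and \<open>l\<close> with \<open>z\<close> agree
  modulo \<open>M\<close>; for \<open>M > 0\<close> the two characters then coincide at all lattice
  nodes.\<close>

definition aliased :: "int \<times> int \<Rightarrow> nat \<Rightarrow> int \<times> int \<Rightarrow> int \<times> int \<Rightarrow> bool" where
  "aliased z M k l \<longleftrightarrow> int M dvd (fst k - fst l) * fst z + (snd k - snd l) * snd z"

text \<open>The coefficient is the mean of the powers \<open>w ^ j\<close> of an \<open>M\<close>-th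
  root of unity: 1 if \<open>w = 1\<close>, and 0 otherwise by the geometric sum.\<close>

lemma lattice_coeff_torus_char:
  assumes "M > 0"
  shows "lattice_coeff z M (torus_char k) l = of_bool (aliased z M k l)"
proof -
  define m where "m = (fst k - fst l) * fst z + (snd k - snd l) * snd z"
  define w where "w = exp (2 * of_real pi * \<i> * of_int m / of_nat M)"
  have w: "torus_char k (lattice_node z M j) * torus_char (- l) (lattice_node z M j) = w ^ j" for j
    unfolding torus_char_add [symmetric] torus_char_lattice_node w_def exp_of_nat_mult [symmetric] m_def
    by (simp add: exp_add [symmetric] algebra_simps add_divide_distrib diff_divide_distrib)
  have wM: "w ^ M = 1"
    using assms exp_integer_2pi [of "of_int m"] unfolding w_def exp_of_nat_mult [symmetric] by (simp add: mult_ac)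
  have w1: "w = 1 \<longleftrightarrow> int M dvd m"
  proof
    assume "w = 1"
    then obtain n :: int where "2 * pi * real_of_int m / real M = of_int (2 * n) * pi"
      unfolding w_def exp_eq_1 by auto
    then have "real_of_int m = real_of_int n * real M"
      using assms by (simp add: field_simps)
    then have "m = n * int M"
      by (metis of_int_eq_iff of_int_mult of_int_of_nat_eq)
    then show "int M dvd m" by simp
  next
    assume "int M dvd m"
    then obtain n where "m = int M * n" ..
    then show "w = 1"
      using assms exp_integer_2pi [of "of_int n"] by (simp add: w_def mult_ac)
  qed
  have "(\<Sum>j<M. w ^ j) = (if w = 1 then of_nat M else 0)"
    using wM by (simp add: sum_gp_strict)
  then show ?thesis
    using assms w1 unfolding lattice_coeff_def w by (auto simp: aliased_def m_def)
qed

lemma torus_char_in_trig_polys: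
  assumes "finite I" "k \<in> I"
  shows "torus_char k \<in> trig_polys I"
proof -
  have "torus_char k = (\<lambda>x. \<Sum>l\<in>I. of_bool (l = k) * torus_char l x)"
    using assms by (intro ext) simp
  then show ?thesis
    unfolding trig_polys_def by (intro CollectI exI [of _ "\<lambda>l. of_bool (l = k)"])
qed

text \<open>Evaluating the reproduced character at the origin counts the frequencies in \<open>I\<close> aliased to it.\<close>

lemma aliased_reconstructing_eq:
  assumes "reconstructing_lattice z M I" "finite I" "M > 0" "k \<in> I"
  shows "{l \<in> I. aliased z M k l} = {k}"
proof -
  have "sampling_op I z M (torus_char k) 0 = torus_char k 0"
    using assms torus_char_in_trig_polys unfolding reconstructing_lattice_def by metis
  moreover have "sampling_op I z M (torus_char k) 0 = of_nat (card {l \<in> I. aliased z M k l})"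
    using assms by (simp add: sampling_op_def lattice_coeff_torus_char Int_def)
  ultimately have "card {l \<in> I. aliased z M k l} = 1"
    by (metis of_nat_eq_1_iff torus_char_at_0)
  moreover have "k \<in> {l \<in> I. aliased z M k l}"
    using assms by (simp add: aliased_def)
  ultimately show ?thesis
    by (metis (lifting) card_1_singletonE singletonD)
qed

lemma sampling_op_torus_char_in:
  assumes "reconstructing_lattice z M I" "finite I" "k \<in> I"
  shows "sampling_op I z M (torus_char k) = torus_char k"
  using assms torus_char_in_trig_polys unfolding reconstructing_lattice_def by blast

text \<open>Two frequencies of \<open>I\<close> aliased to the same \<open>k\<close> are aliased to
  each other, hence equal. At most one term of modulus 1 survives, also for \<open>k\<close> outside
  \<open>I\<close>.\<close>

lemma norm_sampling_op_torus_char_le: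
  assumes "reconstructing_lattice z M I" "finite I" "M > 0"
  shows "cmod (sampling_op I z M (torus_char k) x) \<le> 1"
proof -
  have unique: "l = l'" if "l \<in> I" "l' \<in> I" "aliased z M k l" "aliased z M k l'" for l l'
  proof -
    have "int M dvd ((fst k - fst l') * fst z + (snd k - snd l') * snd z)
        - ((fst k - fst l) * fst z + (snd k - snd l) * snd z)"
      using that unfolding aliased_def by (intro dvd_diff)
    then have "aliased z M l l'"
      by (simp add: aliased_def algebra_simps)
    then have "l' \<in> {m \<in> I. aliased z M l m}"
      using that by simp
    then show ?thesis
      using aliased_reconstructing_eq [OF assms that(1)] by simp
  qed
  have "cmod (sampling_op I z M (torus_char k) x) \<le> (\<Sum>l\<in>I. of_bool (aliased z M k l))"
    unfolding sampling_op_def lattice_coeff_torus_char [OF assms(3)]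
    by (rule sum_norm_le) (simp add: norm_mult)
  also have "\<dots> = card {l \<in> I. aliased z M k l}"
    using assms(2) by (simp add: Int_def)
  also have "\<dots> \<le> 1"
    using unique assms(2) by (simp add: card_le_Suc0_iff_eq)
  finally show ?thesis .
qed

section \<open>The error estimate\<close>

lemma has_sum_finite_sum:
  fixes f :: "'a \<Rightarrow> 'b \<Rightarrow> 'c::topological_comm_monoid_add"
  assumes "\<And>i. i \<in> I \<Longrightarrow> (f i has_sum s i) A"
  shows "((\<lambda>k. \<Sum>i\<in>I. f i k) has_sum (\<Sum>i\<in>I. s i)) A"
  using assms
  by (induction I rule: infinite_finite_induct) (auto intro!: has_sum_add)

text \<open>The sampling operator is a finite linear combination of point evaluations, so it may be
  applied to the series term by term.\<close>

lemma sampling_op_fourier_series_has_sum: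
  assumes "(\<lambda>k. cmod (a k)) summable_on UNIV"
  shows "((\<lambda>k. a k * sampling_op I z M (torus_char k) x) has_sum sampling_op I z M (fourier_series a) x) UNIV"
proof -
  have "((\<lambda>k. \<Sum>l\<in>I. (1 / of_nat M * (\<Sum>j<M. (a k * torus_char k (lattice_node z M j)) *
      torus_char (- l) (lattice_node z M j))) * torus_char l x)
    has_sum sampling_op I z M (fourier_series a) x) UNIV"
    unfolding sampling_op_def lattice_coeff_def
    by (intro has_sum_finite_sum has_sum_cmult_left has_sum_cmult_right fourier_series_has_sum assms)
  then show ?thesis
    by (simp add: sampling_op_def lattice_coeff_def sum_distrib_left sum_distrib_right mult_ac)
qed

text \<open>The error is a series whose terms vanish on \<open>I\<close> and are at most
  \<open>2 * cmod (a k)\<close> elsewhere. Its finite partial sums are bounded by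
  \<open>2 * B\<close>, and the bound passes to the limit.\<close>

lemma sampling_error_fourier_series_le:
  assumes rec: "reconstructing_lattice z M I" "finite I" "M > 0"
    and summable: "(\<lambda>k. cmod (a k)) summable_on UNIV"
    and tail: "\<And>F. finite F \<Longrightarrow> F \<inter> I = {} \<Longrightarrow> (\<Sum>k\<in>F. cmod (a k)) \<le> B"
  shows "cmod (fourier_series a x - sampling_op I z M (fourier_series a) x) \<le> 2 * B"
proof -
  let ?e = "\<lambda>k. a k * torus_char k x - a k * sampling_op I z M (torus_char k) x"
  have "((\<lambda>k. a k * torus_char k x + - (a k * sampling_op I z M (torus_char k) x)) has_sum
      (fourier_series a x + - sampling_op I z M (fourier_series a) x)) UNIV"
    by (intro has_sum_add has_sum_uminusI fourier_series_has_sum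
        sampling_op_fourier_series_has_sum summable)
  then have "(?e has_sum (fourier_series a x - sampling_op I z M (fourier_series a) x)) UNIV"
    by simp
  then have lim: "(sum ?e \<longlongrightarrow> fourier_series a x - sampling_op I z M (fourier_series a) x) (finite_subsets_at_top UNIV)"
    by (simp add: has_sum_def)
  have bound: "cmod (sum ?e F) \<le> 2 * B" if "finite F" for F
  proof -
    have zero: "?e k = 0" if "k \<in> I" for k
      using sampling_op_torus_char_in [OF rec(1,2) that] by simp
    have le: "cmod (?e k) \<le> 2 * cmod (a k)" for k
    proof -
      have "cmod (torus_char k x - sampling_op I z M (torus_char k) x) \<le> 2"
        using norm_triangle_ineq4 [of "torus_char k x" "sampling_op I z M (torus_char k) x"]
          norm_sampling_op_torus_char_le [OF rec, of k x] by simp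
      then have "cmod (a k) * cmod (torus_char k x - sampling_op I z M (torus_char k) x) \<le> cmod (a k) * 2"
        by (intro mult_left_mono) auto
      then show ?thesis
        by (simp add: norm_mult [symmetric] right_diff_distrib)
    qed
    have "sum ?e F = sum ?e (F - I)"
      using that zero by (intro sum.mono_neutral_right) auto
    also have "cmod \<dots> \<le> (\<Sum>k\<in>F - I. 2 * cmod (a k))"
      by (intro sum_norm_le le)
    also have "\<dots> = 2 * (\<Sum>k\<in>F - I. cmod (a k))"
      by (simp add: sum_distrib_left)
    also have "\<dots> \<le> 2 * B"
      using that tail [of "F - I"] by auto
    finally show ?thesis .
  qed
  show ?thesis
  proof (rule tendsto_upperbound [OF tendsto_norm [OF lim]])
    show "eventually (\<lambda>F. cmod (sum ?e F) \<le> 2 * B) (finite_subsets_at_top UNIV)"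
      by (rule eventually_finite_subsets_at_top_weakI) (rule bound)
  qed simp
qed

section \<open>Frequencies outside the grid and the final bound\<close>

lemma finite_freq_grid: "finite (freq_grid R)"
proof -
  define n where "n = \<lceil>(2::real) powr (of_int \<lfloor>R\<rfloor> - 1)\<rceil>"
  have "freq_grid R \<subseteq> {-n..n} \<times> {-n..n}"
    unfolding freq_grid_def n_def by (auto simp: le_ceiling_iff ceiling_le_iff) linarith+
  then show ?thesis
    by (rule finite_subset) simp
qed

text \<open>A coordinate that violates the grid condition has absolute value at least
  \<open>2 powr (\<lfloor>R\<rfloor> - 1)\<close>, and
  \<open>\<lfloor>R\<rfloor> \<ge> R - 1\<close>.\<close>

lemma not_in_freq_grid:
  assumes "k \<notin> freq_grid R"
  shows "2 powr (R - 2) \<le> \<bar>real_of_int (fst k)\<bar> \<or> 2 powr (R - 2) \<le> \<bar>real_of_int (snd k)\<bar>"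
proof -
  define P where "P = (2::real) powr (of_int \<lfloor>R\<rfloor> - 1)"
  have "2 powr (R - 2) \<le> P"
    unfolding P_def by (intro powr_mono) linarith+
  then show ?thesis
    using assms unfolding freq_grid_def P_def [symmetric] by auto
qed

lemma Hmix_sampling_error_le:
  assumes \<alpha>: "\<alpha> > 1/2" and f: "f \<in> Hmix \<alpha>" "Hmix_norm \<alpha> f \<le> 1"
    and rec: "reconstructing_lattice z M (freq_grid R)" "M > 0"
  shows "Linf_norm (\<lambda>x. f x - sampling_op (freq_grid R) z M (continuous_rep f) x)
    \<le> ereal (2 * sqrt (tail_const \<alpha> * (2 powr (R - 2)) powr (1 - 2 * \<alpha>)))"
proof -
  let ?a = "fourier_coeff f" and ?I = "freq_grid R"
  let ?B = "sqrt (tail_const \<alpha> * (2 powr (R - 2)) powr (1 - 2 * \<alpha>))"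
  note summable = Hmix_abs_summable [OF \<alpha> f(1)]
  have tail: "(\<Sum>k\<in>F. cmod (?a k)) \<le> ?B" if "finite F" "F \<inter> ?I = {}" for F
  proof -
    have "(\<Sum>k\<in>F. cmod (?a k)) \<le> Hmix_norm \<alpha> f * ?B"
      unfolding Hmix_norm_def using that f(1)
      by (intro sum_norm_tail_le \<alpha> not_in_freq_grid) (auto simp: Hmix_def)
    also have "\<dots> \<le> 1 * ?B"
      using f(2) tail_const_pos [OF \<alpha>] by (intro mult_right_mono) auto
    finally show ?thesis by simp
  qed
  \<comment> \<open>Measurability of the error is needed because \<open>esssup\<close> defaults to
    \<open>top\<close> on functions that are not measurable.\<close>
  have meas: "f \<in> borel_measurable torus_measure"
    using f(1) by (simp add: Hmix_def L2_torus_def)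
  have "sampling_op ?I z M (continuous_rep f) \<in> borel_measurable torus_measure"
    unfolding sampling_op_def by measurable
  then have "(\<lambda>x. ereal (cmod (f x - sampling_op ?I z M (continuous_rep f) x))) \<in> borel_measurable torus_measure"
    using meas by measurable
  moreover have "AE x in torus_measure. ereal (cmod (f x - sampling_op ?I z M (continuous_rep f) x)) \<le> ereal (2 * ?B)"
    using Hmix_AE_fourier_series [OF \<alpha> f(1)]
  proof eventually_elim
    case (elim x)
    show ?case
      unfolding elim continuous_rep_Hmix [OF \<alpha> f(1)] ereal_less_eq
      by (rule sampling_error_fourier_series_le [OF rec(1) finite_freq_grid rec(2) summable tail])
  qed
  ultimately show ?thesis
    unfolding Linf_norm_def by (rule esssup_I)
qed

theorem proposition5p6:
  fixes \<alpha> c1 c2 :: real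
  assumes "\<alpha> > 1/2" and "0 < c1" and "c1 \<le> c2"
  shows "\<exists>C>0. \<forall>(R::real) (z::int \<times> int) (M::nat).
           R \<ge> 0 \<longrightarrow> reconstructing_lattice z M (freq_grid R) \<longrightarrow>
           c1 * 2 powr (2 * R) \<le> real M \<longrightarrow> real M \<le> c2 * 2 powr (2 * R) \<longrightarrow>
           operator_norm (Hmix \<alpha>) (Hmix_norm \<alpha>) Linf_norm
             (\<lambda>f x. f x - sampling_op (freq_grid R) z M (continuous_rep f) x)
           \<le> ereal (C * real M powr (- (\<alpha> - 1/2) / 2))"
proof -
  \<comment> \<open>The factor 2 is that of the error bound. The factor \<open>16 * c2\<close>
    arises because the square of \<open>2 powr (R - 2)\<close> is
    \<open>2 powr (2 * R) / 16\<close>, which is at least \<open>M / (16 * c2)\<close>.\<close>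
  define C where "C = 2 * sqrt (tail_const \<alpha> * (16 * c2) powr (\<alpha> - 1/2))"
  have "C > 0"
    using assms tail_const_pos unfolding C_def by simp
  moreover have "operator_norm (Hmix \<alpha>) (Hmix_norm \<alpha>) Linf_norm
      (\<lambda>f x. f x - sampling_op (freq_grid R) z M (continuous_rep f) x)
    \<le> ereal (C * real M powr (- (\<alpha> - 1/2) / 2))"
    if rec: "reconstructing_lattice z M (freq_grid R)"
      and M: "c1 * 2 powr (2 * R) \<le> real M" "real M \<le> c2 * 2 powr (2 * R)" for R z M
  proof -
    \<comment> \<open>The lower bound on \<open>M\<close> makes it positive, as the aliasing lemmas
      and the laws of real powers require.\<close>
    have "0 < c1 * 2 powr (2 * R)"
      using assms by simp
    then have M0: "M > 0"
      using M(1) by linarith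
    have "(2 powr (R - 2)) powr (1 - 2 * \<alpha>) = ((2 powr (R - 2)) powr 2) powr (- (\<alpha> - 1/2))"
      unfolding powr_powr by (simp add: algebra_simps)
    also have "(2 powr (R - 2)) powr 2 = (2::real) powr (2 * R) / 16"
      unfolding powr_powr by (simp add: algebra_simps powr_diff)
    \<comment> \<open>The exponent is negative, so the upper bound on \<open>M\<close> is the one
      that gives this estimate.\<close>
    also have "(2 powr (2 * R) / 16) powr (- (\<alpha> - 1/2)) \<le> (real M / (16 * c2)) powr (- (\<alpha> - 1/2))"
      using M M0 assms by (intro powr_mono2') (auto simp: field_simps)
    also have "\<dots> = (16 * c2) powr (\<alpha> - 1/2) * real M powr (- (\<alpha> - 1/2))"
      using M0 assms by (simp add: powr_divide powr_minus field_simps)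
    finally have "2 * sqrt (tail_const \<alpha> * (2 powr (R - 2)) powr (1 - 2 * \<alpha>))
        \<le> 2 * sqrt (tail_const \<alpha> * ((16 * c2) powr (\<alpha> - 1/2) * real M powr (- (\<alpha> - 1/2))))"
      using tail_const_pos [OF assms(1)] by simp
    also have "\<dots> = C * sqrt (real M powr (- (\<alpha> - 1/2)))"
      by (simp add: C_def real_sqrt_mult)
    also have "sqrt (real M powr (- (\<alpha> - 1/2))) = real M powr (- (\<alpha> - 1/2) / 2)"
      using M0 by (simp add: powr_half_sqrt [symmetric] powr_powr)
    finally have le: "ereal (2 * sqrt (tail_const \<alpha> * (2 powr (R - 2)) powr (1 - 2 * \<alpha>)))
        \<le> ereal (C * real M powr (- (\<alpha> - 1/2) / 2))"
      by simp
    show ?thesis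
      unfolding operator_norm_def
    proof (rule SUP_least)
      fix f assume "f \<in> {f \<in> Hmix \<alpha>. Hmix_norm \<alpha> f \<le> 1}"
      then have "f \<in> Hmix \<alpha>" "Hmix_norm \<alpha> f \<le> 1"
        by auto
      from order_trans [OF Hmix_sampling_error_le [OF assms(1) this rec M0] le]
      show "Linf_norm (\<lambda>x. f x - sampling_op (freq_grid R) z M (continuous_rep f) x)
          \<le> ereal (C * real M powr (- (\<alpha> - 1/2) / 2))" .
    qed
  qed
  ultimately show ?thesis by blast
qed

end
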